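(* Let $G$ be a twin-free graph of order $n$ with no isolated vertices. Then $\gamma_L(G) \le \frac{2n}{3}$.
   Context: Graphs are finite, simple and undirected; the order of a graph is its number of vertices. For a vertex $v$ of $G$, $N(v)$ denotes its open neighborhood (the set of vertices adjacent to $v$) and $N[v] = N(v)\cup\{v\}$ its closed neighborhood. Two distinct vertices $u,v$ are twins if $N(u)=N(v)$ (open twins) or $N[u]=N[v]$ (closed twins). A graph is twin-free if it has no twins. A dominating set of $G$ is a set $D\subseteq V(G)$ such that every vertex outside $D$ has a neighbor in $D$. A locating-dominating set of $G$ is a dominating set $D$ such that $N(u)\cap D\neq N(v)\cap D$ for every two distinct vertices $u,v\in V(G)\setminus D$. The location-domination number $\gamma_L(G)$ is the minimum cardinality of a locating-dominating set of $G$. *)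

theory Defs
  imports Complex_Main "Graph_Theory.Digraph"
begin

text \<open>
  Finite simple undirected graphs are the library's \<open>graph\<close>: finite, loop-free, symmetric
  digraphs without parallel arcs, so that an edge is a pair of opposite arcs and adjacency of
  \<open>u\<close> and \<open>v\<close> is \<open>u \<rightarrow>\<^bsub>G\<^esub> v\<close>. This includes the null graph.
\<close>

definition open_neighborhood :: "('a, 'b) pre_digraph \<Rightarrow> 'a \<Rightarrow> 'a set" where
  "open_neighborhood G v = {u \<in> verts G. v \<rightarrow>\<^bsub>G\<^esub> u}"

definition closed_neighborhood :: "('a, 'b) pre_digraph \<Rightarrow> 'a \<Rightarrow> 'a set" where
  "closed_neighborhood G v = open_neighborhood G v \<union> {v}"

definition isolated_vertex :: "('a, 'b) pre_digraph \<Rightarrow> 'a \<Rightarrow> bool" where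
  "isolated_vertex G v \<longleftrightarrow> v \<in> verts G \<and> open_neighborhood G v = {}"

definition twins :: "('a, 'b) pre_digraph \<Rightarrow> 'a \<Rightarrow> 'a \<Rightarrow> bool" where
  "twins G u v \<longleftrightarrow> u \<in> verts G \<and> v \<in> verts G \<and> u \<noteq> v \<and>
     (open_neighborhood G u = open_neighborhood G v \<or>
      closed_neighborhood G u = closed_neighborhood G v)"

definition twin_free :: "('a, 'b) pre_digraph \<Rightarrow> bool" where
  "twin_free G \<longleftrightarrow> (\<nexists>u v. twins G u v)"

definition dominating_set :: "('a, 'b) pre_digraph \<Rightarrow> 'a set \<Rightarrow> bool" where
  "dominating_set G D \<longleftrightarrow> D \<subseteq> verts G \<and>
     (\<forall>v \<in> verts G - D. \<exists>u \<in> D. u \<in> open_neighborhood G v)"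

definition locating_dominating_set :: "('a, 'b) pre_digraph \<Rightarrow> 'a set \<Rightarrow> bool" where
  "locating_dominating_set G D \<longleftrightarrow> dominating_set G D \<and>
     (\<forall>u \<in> verts G - D. \<forall>v \<in> verts G - D. u \<noteq> v \<longrightarrow>
        open_neighborhood G u \<inter> D \<noteq> open_neighborhood G v \<inter> D)"

definition location_domination_number :: "('a, 'b) pre_digraph \<Rightarrow> nat" where
  "location_domination_number G =
     (LEAST k. \<exists>D. locating_dominating_set G D \<and> card D = k)"

lemma locating_dominating_set_verts: "locating_dominating_set G (verts G)"
  by (simp add: locating_dominating_set_def dominating_set_def)

lemma location_domination_number_attained:
  "\<exists>D. locating_dominating_set G D \<and> card D = location_domination_number G"
  unfolding location_domination_number_def
  by (rule LeastI_ex) (use locating_dominating_set_verts in blast)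

lemma location_domination_number_le:
  "locating_dominating_set G D \<Longrightarrow> location_domination_number G \<le> card D"
  unfolding location_domination_number_def by (rule Least_le) blast

end

theory Submission
  imports Defs
begin

text \<open>
  For a vertex set \<open>D\<close>, sort the vertices outside \<open>D\<close> by their trace \<open>N(v) \<inter> D\<close>, and let \<open>g(D)\<close> be
  the number of nonempty traces. Keeping one representative of each nonempty trace out of the
  vertex set leaves a locating-dominating set of size \<open>n - g(D)\<close>.

  Now take \<open>D\<close> of maximum cardinality subject to \<open>|D| \<le> g(D)\<close>, so that adding a vertex to \<open>D\<close> never
  increases \<open>g\<close>. Let \<open>S\<close> be the set of vertices having a nonempty trace which no other vertex shares.
  If a vertex \<open>w\<close> outside \<open>D \<union> S\<close> separated two vertices with equal traces, or dominated a vertex with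
  empty trace, then adding \<open>w\<close> to \<open>D\<close> would destroy no trace and create a new one. Hence all such
  separations are due to \<open>S\<close>, and twin-freeness makes \<open>D \<union> S\<close> locating-dominating. As \<open>|D|\<close> and \<open>|S|\<close>
  are at most \<open>g(D)\<close>, the location-domination number is at most the minimum of \<open>n - g(D)\<close> and
  \<open>2 g(D)\<close>, hence at most \<open>2n/3\<close>.
\<close>

definition traces :: "('a, 'b) pre_digraph \<Rightarrow> 'a set \<Rightarrow> 'a set set" where
  "traces G D = (\<lambda>v. open_neighborhood G v \<inter> D) ` (verts G - D) - {{}}"

definition uniquely_traced :: "('a, 'b) pre_digraph \<Rightarrow> 'a set \<Rightarrow> 'a set" where
  "uniquely_traced G D = {v \<in> verts G - D. open_neighborhood G v \<inter> D \<noteq> {} \<and>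
     (\<forall>u \<in> verts G - D. open_neighborhood G u \<inter> D = open_neighborhood G v \<inter> D \<longrightarrow> u = v)}"

lemma open_neighborhood_commute:
  assumes "graph G" "u \<in> open_neighborhood G v"
  shows "v \<in> open_neighborhood G u"
proof -
  interpret graph G by fact
  show ?thesis
    using assms(2) sym_arcs by (auto simp: open_neighborhood_def symmetric_def adj_in_verts dest: symD)
qed

lemma not_in_open_neighborhood:
  assumes "graph G"
  shows "v \<notin> open_neighborhood G v"
proof -
  interpret graph G by fact
  show ?thesis
    by (auto simp: open_neighborhood_def dest: adj_not_same)
qed

text \<open>Adjacent vertices are compared by closed neighborhoods and nonadjacent ones by open
  neighborhoods; in either case the two sets agree at \<open>u\<close> and at \<open>v\<close>, so
  they differ at a third vertex.\<close>

lemma not_twins_separated: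
  assumes "graph G" "twin_free G" "u \<in> verts G" "v \<in> verts G" "u \<noteq> v"
  obtains w where "w \<in> verts G" "w \<noteq> u" "w \<noteq> v"
    "w \<in> open_neighborhood G u \<longleftrightarrow> w \<notin> open_neighborhood G v"
proof -
  let ?N = "open_neighborhood G"
  have ne: "?N u \<noteq> ?N v" "?N u \<union> {u} \<noteq> ?N v \<union> {v}"
    using assms unfolding twin_free_def twins_def closed_neighborhood_def by blast+
  have sub: "?N x \<subseteq> verts G" for x
    by (auto simp: open_neighborhood_def)
  have sym: "v \<in> ?N u \<longleftrightarrow> u \<in> ?N v"
    using assms open_neighborhood_commute by metis
  have irr: "u \<notin> ?N u" "v \<notin> ?N v"
    using assms not_in_open_neighborhood by metis+
  have "\<exists>w \<in> verts G. w \<noteq> u \<and> w \<noteq> v \<and> (w \<in> ?N u \<longleftrightarrow> w \<notin> ?N v)"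
  proof (cases "v \<in> ?N u")
    case True
    obtain w where "w \<in> ?N u \<union> {u} \<longleftrightarrow> w \<notin> ?N v \<union> {v}"
      using ne(2) by blast
    then show ?thesis using True sym sub[of u] sub[of v] by (intro bexI[of _ w]) auto
  next
    case False
    obtain w where "w \<in> ?N u \<longleftrightarrow> w \<notin> ?N v"
      using ne(1) by blast
    then show ?thesis using False sym irr sub[of u] sub[of v] by (intro bexI[of _ w]) auto
  qed
  with that show thesis by blast
qed

lemma finite_traces: "finite (verts G) \<Longrightarrow> finite (traces G D)"
  by (simp add: traces_def)

lemma card_uniquely_traced_le:
  assumes "finite (verts G)"
  shows "card (uniquely_traced G D) \<le> card (traces G D)"
proof (rule card_inj_on_le)
  show "inj_on (\<lambda>v. open_neighborhood G v \<inter> D) (uniquely_traced G D)"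
    by (rule inj_onI) (auto simp: uniquely_traced_def)
  show "(\<lambda>v. open_neighborhood G v \<inter> D) ` uniquely_traced G D \<subseteq> traces G D"
    by (auto simp: uniquely_traced_def traces_def)
qed (simp add: assms finite_traces)

lemma locating_dominating_set_of_traces:
  assumes "finite (verts G)"
  shows "\<exists>B. locating_dominating_set G B \<and> card B + card (traces G D) = card (verts G)"
proof -
  let ?t = "\<lambda>v. open_neighborhood G v \<inter> D"
  have "traces G D \<subseteq> ?t ` (verts G - D)"
    by (auto simp: traces_def)
  then have "\<exists>R \<subseteq> verts G - D. inj_on ?t R \<and> traces G D = ?t ` R"
    by (simp only: subset_image_inj)
  then obtain R where R: "R \<subseteq> verts G - D" "inj_on ?t R" "?t ` R = traces G D"
    by (elim exE conjE) simp
  define B where "B = verts G - R"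
  \<comment> \<open>\<open>D\<close> may contain elements outside \<open>verts G\<close>, so only
    those lying in some neighborhood are claimed to be in \<open>B\<close>.\<close>
  have compl: "verts G - B = R" and DB: "x \<in> D \<Longrightarrow> x \<in> open_neighborhood G v \<Longrightarrow> x \<in> B" for x v
    using R(1) by (auto simp: B_def open_neighborhood_def)
  have "\<exists>u \<in> B. u \<in> open_neighborhood G v" if "v \<in> R" for v
  proof -
    have "?t v \<noteq> {}" using that R(3) by (auto simp: traces_def)
    then show ?thesis using DB by blast
  qed
  moreover have "open_neighborhood G u \<inter> B \<noteq> open_neighborhood G v \<inter> B"
    if "u \<in> R" "v \<in> R" "u \<noteq> v" for u v
    using inj_onD[OF R(2), of u v] that DB by blast
  ultimately have "locating_dominating_set G B"
    unfolding locating_dominating_set_def dominating_set_def compl by (auto simp: B_def)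
  moreover have "card B + card (traces G D) = card (verts G)"
  proof -
    have "card (traces G D) = card R" using card_image[OF R(2)] R(3) by simp
    moreover have "R \<subseteq> verts G" using R(1) by auto
    ultimately show ?thesis
      using assms by (simp add: B_def card_Diff_subset finite_subset card_mono)
  qed
  ultimately show ?thesis by blast
qed

text \<open>Deleting \<open>w\<close> from the new traces recovers every old one, even when the new
  trace \<open>insert w A\<close> of \<open>u\<close> is left out.\<close>

lemma card_traces_insert_less:
  assumes "finite (verts G)" "w \<in> verts G - D" "w \<notin> uniquely_traced G D"
    and "u \<in> verts G - D" "v \<in> verts G - D" "u \<noteq> w" "v \<noteq> w"
    and u: "w \<in> open_neighborhood G u"
    and uv: "open_neighborhood G u \<inter> D = {} \<or>
      w \<notin> open_neighborhood G v \<and> open_neighborhood G u \<inter> D = open_neighborhood G v \<inter> D"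
  shows "card (traces G D) < card (traces G (insert w D))"
proof -
  let ?N = "open_neighborhood G" and ?T = "traces G (insert w D)"
  define A where "A = ?N u \<inter> D"
  have wA: "w \<notin> A" using assms(2) by (auto simp: A_def)
  have "?N u \<inter> insert w D = insert w A"
    using u by (auto simp: A_def)
  then have uT: "insert w A \<in> ?T"
    using assms(4,6) by (auto simp: traces_def)
  have "traces G D \<subseteq> (\<lambda>X. X - {w}) ` (?T - {insert w A})"
  proof
    fix X assume X: "X \<in> traces G D"
    then obtain y0 where y0: "y0 \<in> verts G - D" "X = ?N y0 \<inter> D" "X \<noteq> {}"
      by (auto simp: traces_def)
    \<comment> \<open>If \<open>w\<close> itself has the trace \<open>X\<close>, then another vertex
      shares it, because \<open>w\<close> is not uniquely traced.\<close>
    obtain y where y: "y \<in> verts G - D" "X = ?N y \<inter> D" "y \<noteq> w"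
      using y0 assms(2,3) unfolding uniquely_traced_def by blast
    \<comment> \<open>A vertex with trace \<open>A\<close> might be adjacent to \<open>w\<close> and
      yield the excluded \<open>insert w A\<close>; \<open>v\<close> is not, and it keeps the trace
      \<open>A\<close>.\<close>
    obtain z where z: "z \<in> verts G - D" "X = ?N z \<inter> D" "z \<noteq> w" "w \<notin> ?N z \<or> X \<noteq> A"
    proof (cases "X = A")
      case True
      then show thesis using that[of v] uv y0(3) assms(5,7) by (auto simp: A_def)
    qed (use that y in blast)
    have "?N z \<inter> insert w D \<in> ?T" using z(1-3) y0(3) by (auto simp: traces_def)
    moreover have X_eq: "X = ?N z \<inter> insert w D - {w}"
      using z(2) assms(2) by auto
    moreover have "?N z \<inter> insert w D \<noteq> insert w A"
    proof
      assume eq: "?N z \<inter> insert w D = insert w A"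
      then have "X = A" using X_eq wA by simp
      moreover have "w \<in> ?N z" using eq by blast
      ultimately show False using z(4) by simp
    qed
    ultimately show "X \<in> (\<lambda>X. X - {w}) ` (?T - {insert w A})" by blast
  qed
  then have "card (traces G D) \<le> card (?T - {insert w A})"
    using finite_traces[OF assms(1)] by (meson card_image_le card_mono finite_Diff finite_imageI le_trans)
  also have "\<dots> < card ?T"
    using uT finite_traces[OF assms(1)] by (intro card_Diff1_less)
  finally show ?thesis .
qed

lemma locating_dominating_set_Un_uniquely_traced:
  assumes "graph G" "twin_free G" "\<nexists>v. isolated_vertex G v" "D \<subseteq> verts G"
    and max: "\<And>w. w \<in> verts G - D \<Longrightarrow> card (traces G (insert w D)) \<le> card (traces G D)"
  shows "locating_dominating_set G (D \<union> uniquely_traced G D)"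
proof -
  interpret graph G by fact
  let ?N = "open_neighborhood G" and ?S = "uniquely_traced G D"
  have S: "w \<in> ?S" if "w \<in> verts G - D" "u \<in> verts G - D" "v \<in> verts G - D" "u \<noteq> w" "v \<noteq> w"
    "w \<in> ?N u" "?N u \<inter> D = {} \<or> w \<notin> ?N v \<and> ?N u \<inter> D = ?N v \<inter> D" for u v w
    using card_traces_insert_less[of G w D u v] max[of w] that by fastforce
  have "\<exists>u \<in> D \<union> ?S. u \<in> ?N v" if v: "v \<in> verts G - (D \<union> ?S)" for v
  proof (cases "?N v \<inter> D = {}")
    case True
    obtain w where w: "w \<in> ?N v" "w \<in> verts G"
      using assms(3) v unfolding isolated_vertex_def open_neighborhood_def by blast
    then have "v \<noteq> w" using not_in_open_neighborhood[OF assms(1)] by auto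
    \<comment> \<open>An empty trace needs no comparison vertex, so \<open>v\<close> fills both
      places.\<close>
    then have "w \<in> ?S" using S[of w v v] w v True by blast
    then show ?thesis using w by blast
  qed blast
  moreover have "?N u \<inter> (D \<union> ?S) \<noteq> ?N v \<inter> (D \<union> ?S)"
    if u: "u \<in> verts G - (D \<union> ?S)" and v: "v \<in> verts G - (D \<union> ?S)" and "u \<noteq> v" for u v
  proof
    assume eq: "?N u \<inter> (D \<union> ?S) = ?N v \<inter> (D \<union> ?S)"
    obtain w where w: "w \<in> verts G" "w \<noteq> u" "w \<noteq> v" "w \<in> ?N u \<longleftrightarrow> w \<notin> ?N v"
      using not_twins_separated[OF assms(1,2)] u v \<open>u \<noteq> v\<close> by blast
    have wD: "w \<notin> D \<union> ?S" and tr: "?N u \<inter> D = ?N v \<inter> D" using eq w by blast+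
    \<comment> \<open>Either of \<open>u\<close> and \<open>v\<close> may be the one adjacent to
      \<open>w\<close>, hence both orders.\<close>
    then show False using S[of w u v] S[of w v u] w u v by blast
  qed
  moreover have "D \<union> ?S \<subseteq> verts G" using assms(4) by (auto simp: uniquely_traced_def)
  ultimately show ?thesis
    unfolding locating_dominating_set_def dominating_set_def by blast
qed

theorem theorem4:
  fixes G :: "('a, 'b) pre_digraph" and n :: nat
  assumes "graph G"
    and "card (verts G) = n"
    and "twin_free G"
    and "\<nexists>v. isolated_vertex G v"
  shows "real (location_domination_number G) \<le> 2 * real n / 3"
proof -
  interpret graph G by fact
  let ?P = "\<lambda>D. D \<subseteq> verts G \<and> card D \<le> card (traces G D)"
  have "\<exists>D. ?P D \<and> (\<forall>D'. ?P D' \<longrightarrow> card D' \<le> card D)"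
    by (rule ex_has_greatest_nat[of ?P "{}" card "Suc (card (verts G))"])
      (auto simp: less_Suc_eq_le card_mono)
  then obtain D where D: "D \<subseteq> verts G" "card D \<le> card (traces G D)"
    and greatest: "\<And>D'. ?P D' \<Longrightarrow> card D' \<le> card D"
    by blast
  have "card (traces G (insert w D)) \<le> card (traces G D)" if "w \<in> verts G - D" for w
  proof -
    have "card (insert w D) = Suc (card D)"
      using that D(1) finite_subset by fastforce
    \<comment> \<open>One more trace would pay for the one added vertex, so
      \<open>insert w D\<close> would be a larger admissible set.\<close>
    then show ?thesis using greatest[of "insert w D"] that D by fastforce
  qed
  then have "locating_dominating_set G (D \<union> uniquely_traced G D)"
    using locating_dominating_set_Un_uniquely_traced assms D(1) by blast
  then have "location_domination_number G \<le> card (D \<union> uniquely_traced G D)"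
    by (rule location_domination_number_le)
  also have "\<dots> \<le> card D + card (uniquely_traced G D)"
    by (rule card_Un_le)
  also have "\<dots> \<le> 2 * card (traces G D)"
    using D(2) card_uniquely_traced_le[of G D] by simp
  finally have "location_domination_number G \<le> 2 * card (traces G D)" .
  moreover have "location_domination_number G + card (traces G D) \<le> n"
    using locating_dominating_set_of_traces[of G D] location_domination_number_le[of G] assms(2)
    by fastforce
  \<comment> \<open>Twice the second bound plus the first eliminates
    \<open>card (traces G D)\<close>.\<close>
  ultimately show ?thesis by simp
qed

end
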